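(* Let $t_1<\dots<t_N$ be real numbers, $t_0=-\infty$, $t_{N+1}=\infty$; put $I_k=(t_k,t_{k+1})$ for $k=0,1,\dots,N$ and $I_{N+k}=\{t_k\}$ for $k=1,\dots,N$. Let $\mathcal{A}$ be the algebra of functions $h:\mathbb{R}\to\mathbb{R}$ that are constant on each $I_k$, $k=0,1,\dots,2N$. Let $\Omega=\{0,1,\dots,2N\}$ and let $\mathbb{R}^{\Omega}$ be the algebra of all functions $f:\Omega\to\mathbb{R}$. Then the algebra $\mathcal{A}$ is isomorphic to the algebra $\mathbb{R}^{\Omega}$.
   Context: Both algebras are real algebras with pointwise addition, multiplication and scalar multiplication; isomorphic means isomorphic as $\mathbb{R}$-algebras. *)

theory Defs
  imports "HOL-Analysis.Analysis" "HOL-Algebra.Algebraic_Closure_Type"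
begin

abbreviation real_field :: "real ring" where
  "real_field \<equiv> ring_of_type_algebra"

(* ring_iso includes preservation of the unit and bijectivity on the carriers. *)
definition algebra_iso ::
  "('r, 'q) ring_scheme \<Rightarrow> ('r, 'a, 'm) module_scheme \<Rightarrow> ('r, 'b, 'n) module_scheme \<Rightarrow> ('a \<Rightarrow> 'b) set"
  where "algebra_iso R A B =
    {\<phi> \<in> ring_iso A B.
      \<forall>c\<in>carrier R. \<forall>a\<in>carrier A. \<phi> (c \<odot>\<^bsub>A\<^esub> a) = c \<odot>\<^bsub>B\<^esub> \<phi> a}"

definition algebra_isomorphic ::
  "('r, 'q) ring_scheme \<Rightarrow> ('r, 'a, 'm) module_scheme \<Rightarrow> ('r, 'b, 'n) module_scheme \<Rightarrow> bool"
  where "algebra_isomorphic R A B \<longleftrightarrow> algebra_iso R A B \<noteq> {}"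

(* A function on S is represented by its extensional extension (undefined outside S);
   for S = UNIV the restrictions below do nothing. *)
definition pointwise_algebra ::
  "'x set \<Rightarrow> ('x \<Rightarrow> real) set \<Rightarrow> (real, 'x \<Rightarrow> real) module"
  where "pointwise_algebra S F =
    \<lparr>carrier = F,
     monoid.mult = (\<lambda>f g. \<lambda>x\<in>S. f x * g x),
     one = (\<lambda>x\<in>S. 1),
     ring.zero = (\<lambda>x\<in>S. 0),
     add = (\<lambda>f g. \<lambda>x\<in>S. f x + g x),
     smult = (\<lambda>c f. \<lambda>x\<in>S. c * f x)\<rparr>"

definition full_function_algebra :: "'x set \<Rightarrow> (real, 'x \<Rightarrow> real) module"
  where "full_function_algebra S = pointwise_algebra S (S \<rightarrow>\<^sub>E UNIV)"

(* Only the values t 1, ..., t N of the sequence t are used. *)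
definition breakpoint :: "nat \<Rightarrow> (nat \<Rightarrow> real) \<Rightarrow> nat \<Rightarrow> ereal"
  where "breakpoint N t k =
    (if k = 0 then -\<infinity> else if k \<le> N then ereal (t k) else \<infinity>)"

definition piece :: "nat \<Rightarrow> (nat \<Rightarrow> real) \<Rightarrow> nat \<Rightarrow> real set"
  where "piece N t k =
    (if k \<le> N then einterval (breakpoint N t k) (breakpoint N t (k + 1)) else {t (k - N)})"

definition piecewise_constant_algebra :: "nat \<Rightarrow> (nat \<Rightarrow> real) \<Rightarrow> (real, real \<Rightarrow> real) module"
  where "piecewise_constant_algebra N t =
    pointwise_algebra UNIV {h. \<forall>k\<in>{0..2 * N}. h constant_on piece N t k}"

lemma algebra_pointwise_algebra:
  assumes F: "F \<subseteq> extensional S"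
    and one: "(\<lambda>x\<in>S. 1) \<in> F"
    and add: "\<And>f g. f \<in> F \<Longrightarrow> g \<in> F \<Longrightarrow> (\<lambda>x\<in>S. f x + g x) \<in> F"
    and mult: "\<And>f g. f \<in> F \<Longrightarrow> g \<in> F \<Longrightarrow> (\<lambda>x\<in>S. f x * g x) \<in> F"
    and smult: "\<And>c f. f \<in> F \<Longrightarrow> (\<lambda>x\<in>S. c * f x) \<in> F"
  shows "Module.algebra real_field (pointwise_algebra S F)"
proof -
  have zero: "(\<lambda>x\<in>S. 0) \<in> F"
    using smult[OF one, of 0] by (simp cong: restrict_cong)
  have ext: "f x = undefined" if "f \<in> F" "x \<notin> S" for f x
    using F that by (auto simp: extensional_def)
  have neg: "\<exists>g\<in>F. (\<lambda>x\<in>S. g x + f x) = (\<lambda>x\<in>S. 0)" if "f \<in> F" for f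
    using smult[OF that, of "-1"]
    by (intro bexI[of _ "\<lambda>x\<in>S. (-1) * f x"]) (auto simp: restrict_def fun_eq_iff)
  note defs = pointwise_algebra_def ring_of_type_algebra_def restrict_def fun_eq_iff
  have cring: "cring (pointwise_algebra S F)"
  proof (rule cringI)
    show "abelian_group (pointwise_algebra S F)"
    proof (rule abelian_groupI, goal_cases)
      case (6 f) then show ?case using neg[of f] by (simp add: pointwise_algebra_def)
    qed (use add zero in \<open>auto simp: pointwise_algebra_def\<close>,
         auto simp: restrict_def fun_eq_iff ext algebra_simps)
    show "Group.comm_monoid (pointwise_algebra S F)"
      by (rule comm_monoidI) (use mult one in \<open>auto simp: pointwise_algebra_def\<close>,
         auto simp: restrict_def fun_eq_iff ext algebra_simps)
  qed (auto simp: defs algebra_simps)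
  show ?thesis
  proof (rule algebraI)
    show "cring real_field" by (rule cring_from_type_algebra)
  qed (use cring smult in \<open>auto simp: pointwise_algebra_def ring_of_type_algebra_def\<close>,
       auto simp: restrict_def fun_eq_iff ext algebra_simps)
qed

lemma algebra_full_function_algebra:
  "Module.algebra real_field (full_function_algebra S)"
  unfolding full_function_algebra_def
  by (rule algebra_pointwise_algebra) (auto simp: PiE_def)

lemma algebra_piecewise_constant_algebra:
  "Module.algebra real_field (piecewise_constant_algebra N t)"
proof -
  have combine: "(\<lambda>x. p (f x) (g x)) constant_on I"
    if "f constant_on I" "g constant_on I" for p :: "real \<Rightarrow> real \<Rightarrow> real" and f g and I :: "real set"
    using that unfolding constant_on_def by metis
  have single: "(\<lambda>x. p (f x)) constant_on I"
    if "f constant_on I" for p :: "real \<Rightarrow> real" and f and I :: "real set"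
    using that unfolding constant_on_def by metis
  have const: "(\<lambda>x. c) constant_on I" for c :: real and I :: "real set"
    unfolding constant_on_def by blast
  show ?thesis
    unfolding piecewise_constant_algebra_def
    by (rule algebra_pointwise_algebra)
       (simp_all add: restrict_def const single[where p = "(*) _"]
          combine[where p = "(+)"] combine[where p = "(*)"])
qed

end

theory Submission
  imports Defs
begin

text \<open>The pieces partition the real line into 2N + 1 nonempty sets, so a function constant on
  each piece amounts to a free choice of one real number per piece. Evaluating at a sample point of
  each piece reads off these numbers and respects all operations, because they are pointwise.
  \<open>algebra_isomorphic_partition\<close> proves this for an arbitrary partition;
  \<open>piece_nonempty\<close>, \<open>piece_cover\<close> and \<open>piece_index_unique\<close>
  show that the intervals and singletons form one.\<close>

lemma algebra_isomorphic_partition: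
  fixes P :: "'k \<Rightarrow> 'x set"
  assumes nonempty: "\<And>k. k \<in> K \<Longrightarrow> P k \<noteq> {}"
    and partition: "\<And>x. \<exists>!k. k \<in> K \<and> x \<in> P k"
  shows "algebra_isomorphic real_field
    (pointwise_algebra UNIV {h. \<forall>k\<in>K. h constant_on P k}) (full_function_algebra K)"
proof -
  let ?A = "{h :: 'x \<Rightarrow> real. \<forall>k\<in>K. h constant_on P k}"
  obtain s where s: "\<And>k. k \<in> K \<Longrightarrow> s k \<in> P k"
    using that[of "\<lambda>k. SOME x. x \<in> P k"] nonempty by (simp add: some_in_eq)
  obtain idx where idx: "\<And>x. idx x \<in> K \<and> x \<in> P (idx x)"
    using partition by metis
  have idx_eq: "idx x = k" if "k \<in> K" "x \<in> P k" for x k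
    using idx partition that by metis
  define \<phi> :: "('x \<Rightarrow> real) \<Rightarrow> 'k \<Rightarrow> real" where "\<phi> = (\<lambda>h. \<lambda>k\<in>K. h (s k))"
  have "bij_betw \<phi> ?A (K \<rightarrow>\<^sub>E UNIV)"
  \<comment> \<open>The inverse spreads a family of values over the pieces: a point x gets the value
    belonging to the piece \<open>idx x\<close> that contains it. One composite is the identity
    since x and \<open>s (idx x)\<close> share a piece, the other since \<open>idx (s k) = k\<close>
    on K.\<close>
  proof (rule bij_betw_byWitness[where f' = "\<lambda>f x. f (idx x)"])
    show "\<forall>h\<in>?A. (\<lambda>x. \<phi> h (idx x)) = h"
    proof
      fix h assume "h \<in> ?A"
      then have "h (s (idx x)) = h x" for x
        using idx[of x] s[of "idx x"] unfolding constant_on_def by fastforce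
      then show "(\<lambda>x. \<phi> h (idx x)) = h"
        using idx by (simp add: \<phi>_def)
    qed
    show "\<forall>f\<in>K \<rightarrow>\<^sub>E UNIV. \<phi> (\<lambda>x. f (idx x)) = f"
      using s idx_eq by (fastforce simp: \<phi>_def PiE_def extensional_def)
    show "\<phi> ` ?A \<subseteq> K \<rightarrow>\<^sub>E UNIV"
      by (auto simp: \<phi>_def)
    show "(\<lambda>f x. f (idx x)) ` (K \<rightarrow>\<^sub>E UNIV) \<subseteq> ?A"
      using idx_eq by (auto simp: constant_on_def)
  qed
  then have "\<phi> \<in> algebra_iso real_field (pointwise_algebra UNIV ?A) (full_function_algebra K)"
    unfolding algebra_iso_def ring_iso_def ring_hom_def full_function_algebra_def
      pointwise_algebra_def
    by (auto simp: \<phi>_def fun_eq_iff)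
  then show ?thesis
    unfolding algebra_isomorphic_def by blast
qed

lemma breakpoint_less:
  assumes "strict_mono_on {1..N} t" "i < j" "j \<le> N + 1"
  shows "breakpoint N t i < breakpoint N t j"
  using assms by (auto simp: breakpoint_def strict_mono_on_def)

lemma breakpoint_less_iff:
  assumes "strict_mono_on {1..N} t" "i \<le> N + 1" "j \<le> N + 1"
  shows "breakpoint N t i < breakpoint N t j \<longleftrightarrow> i < j"
  using breakpoint_less[OF assms(1)] assms(2,3) by (metis less_asym less_irrefl nat_neq_iff)

lemma piece_nonempty:
  assumes "strict_mono_on {1..N} t"
  shows "piece N t k \<noteq> {}"
proof (cases "k \<le> N")
  case True
  then show ?thesis
    \<comment> \<open>A real number lies strictly between any two distinct extended reals, so the
      unbounded end intervals need no separate case.\<close>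
    using ereal_dense2[OF breakpoint_less[OF assms, of k "k + 1"]]
    by (auto simp: piece_def einterval_def)
qed (simp add: piece_def)

lemma piece_cover:
  "\<exists>k\<in>{0..2 * N}. x \<in> piece N t k"
proof (cases "x \<in> t ` {1..N}")
  case True
  then obtain k where "k \<in> {1..N}" "x = t k" by blast
  then show ?thesis
    by (intro bexI[of _ "N + k"]) (auto simp: piece_def)
next
  case False
  \<comment> \<open>For x off the breakpoints, its interval starts at the last breakpoint below x;
    index 0 always qualifies, its breakpoint being -\<infinity>.\<close>
  let ?Q = "\<lambda>k. k \<le> N \<and> breakpoint N t k < ereal x"
  define k where "k = Greatest ?Q"
  have Q0: "?Q 0" by (simp add: breakpoint_def)
  have k: "?Q k"
    unfolding k_def by (rule GreatestI_nat[of ?Q 0 N]) (use Q0 in auto)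
  have "\<not> ?Q (k + 1)"
    using Greatest_le_nat[of ?Q "k + 1" N] by (auto simp: k_def)
  \<comment> \<open>For k < N, maximality gives only \<le>, and x not being a breakpoint makes it
    strict; for k = N the right end is \<infinity>.\<close>
  then have "ereal x < breakpoint N t (k + 1)"
    using False k by (cases "k + 1 \<le> N") (force simp: breakpoint_def not_less le_less)+
  then show ?thesis
    using k by (intro bexI[of _ k]) (auto simp: piece_def einterval_def)
qed

text \<open>By symmetry let i \<le> j. The three cases are two intervals, an interval and a
  singleton, and two singletons. Comparing breakpoints settles the first two, injectivity of
  \<open>t\<close> the third.\<close>

lemma piece_index_unique:
  assumes mono: "strict_mono_on {1..N} t"
    and "i \<le> 2 * N" "j \<le> 2 * N" "x \<in> piece N t i" "x \<in> piece N t j"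
  shows "i = j"
  using assms(2-)
proof (induction i j rule: linorder_wlog)
  case (le i j)
  note less_iff = breakpoint_less_iff[OF mono]
  consider "j \<le> N" | "i \<le> N" "N < j" | "N < i" using le by linarith
  then show ?case
  proof cases
    case 1
    \<comment> \<open>A common point x lies above the left end of interval j and below the right end
      of interval i, which forces j < i + 1.\<close>
    then have "breakpoint N t j < breakpoint N t (i + 1)"
      using le by (auto simp: piece_def einterval_def)
    then show ?thesis using less_iff[of j "i + 1"] 1 le by auto
  next
    case 2
    then have "breakpoint N t (j - N) = ereal x"
      using le by (auto simp: piece_def breakpoint_def)
    moreover have "breakpoint N t i < ereal x" "ereal x < breakpoint N t (i + 1)"
      using 2 le by (auto simp: piece_def einterval_def)
    ultimately have "i < j - N" "j - N < i + 1"
      using less_iff[of i "j - N"] less_iff[of "j - N" "i + 1"] 2 le by simp_all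
    \<comment> \<open>No integer lies strictly between i and i + 1, so this case is
      contradictory.\<close>
    then show ?thesis by simp
  next
    case 3
    then have "t (i - N) = t (j - N)" "i - N \<in> {1..N}" "j - N \<in> {1..N}"
      using le by (auto simp: piece_def)
    then have "i - N = j - N"
      using strict_mono_on_imp_inj_on[OF mono] by (auto dest: inj_onD)
    then show ?thesis using 3 le by simp
  qed
qed auto

theorem proposition2:
  fixes N :: nat and t :: "nat \<Rightarrow> real"
  assumes "strict_mono_on {1..N} t"
  shows "algebra_isomorphic real_field
    (piecewise_constant_algebra N t) (full_function_algebra {0..2 * N})"
  unfolding piecewise_constant_algebra_def
proof (rule algebra_isomorphic_partition)
  show "piece N t k \<noteq> {}" for k
    using assms by (rule piece_nonempty)
  show "\<exists>!k. k \<in> {0..2 * N} \<and> x \<in> piece N t k" for x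
    using piece_cover[of N x t] piece_index_unique[OF assms] by (metis atLeastAtMost_iff)
qed

end
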